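(* For every $\epsilon\in(0,1/2)$ there exists $R>0$ such that for every integer $n\ge0$ there exists a closed set $E\subset\partial T$ with $$\operatorname{Cap}^T(E)\ge\epsilon\quad\text{but}\quad \operatorname{Cap}^T_n(E)\le R .$$
   Context: $T$ is the infinite rooted dyadic tree with root $o$: every vertex $x$ has exactly two children $x_+,x_-$, and every vertex other than $o$ has exactly one parent. $d(x)$ is the number of edges in the geodesic from $o$ to $x$, so $d(o)=0$; $P(x)=[o,x]$ is the set of vertices on this geodesic, endpoints included. The boundary $\partial T$ is the set of half-infinite geodesics starting at $o$; for $\zeta\in\partial T$, $P(\zeta)$ is the set of vertices of the geodesic $\zeta$. For distinct $\xi,\zeta\in\partial T$, $\xi\wedge\zeta$ is the vertex of largest level $d$ in $P(\xi)\cap P(\zeta)$, and $\partial T$ carries the metric $\rho(\xi,\zeta)=2^{-d(\xi\wedge\zeta)}$ (with $\rho(\xi,\xi)=0$); "closed" refers to this metric. For $\varphi:T\to[0,\infty)$ put $I\varphi(\zeta)=\sum_{x\in P(\zeta)}\varphi(x)$ for $\zeta\in T\cup\partial T$, and $\|\varphi\|_{\ell^2}^2=\sum_{x\in T}\varphi(x)^2$. For closed $E\subseteq\partial T$, $$\operatorname{Cap}^T(E)=\inf\{\|\varphi\|_{\ell^2}^2:\ \varphi\ge0,\ I\varphi\ge1\text{ on }E\},$$ and for an integer $n\ge1$, $$\operatorname{Cap}^T_n(E)=\inf\{\|\varphi\|_{\ell^2}^2:\ \varphi\ge0,\ I\varphi\ge1\text{ on }E,\ I\varphi(x)=0\ \text{for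 all }x\in T\text{ with }d(x)=n-1\};$$ also $\operatorname{Cap}^T_0(E)=\operatorname{Cap}^T(E)$. *)

theory Defs
  imports "HOL-Analysis.Analysis" "HOL-Library.Sublist"
begin

text \<open>
  A vertex of the dyadic tree is encoded by the finite sequence of left/right choices leading to it
  from the root \<^term>\<open>[]\<close>; the children of \<^term>\<open>x\<close> are \<^term>\<open>x @ [True]\<close> and
  \<^term>\<open>x @ [False]\<close>. The number of edges from the root to \<^term>\<open>x\<close> is \<^term>\<open>length x\<close>, and
  the vertices on the geodesic from the root to \<^term>\<open>x\<close> are the prefixes of \<^term>\<open>x\<close>.
\<close>

type_synonym vertex = "bool list"

abbreviation level :: "vertex \<Rightarrow> nat" where
  "level x \<equiv> length x"

definition geodesic :: "vertex \<Rightarrow> vertex set" where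
  "geodesic x = {y. prefix y x}"

text \<open>
  A half-infinite geodesic from the root is the sequence of its successive vertices.
\<close>

definition tree_boundary :: "(nat \<Rightarrow> vertex) set" where
  "tree_boundary = {g. g 0 = [] \<and> (\<forall>k. \<exists>b. g (Suc k) = g k @ [b])}"

definition ray :: "(nat \<Rightarrow> vertex) \<Rightarrow> vertex set" where
  "ray \<zeta> = range \<zeta>"

definition tree_meet :: "(nat \<Rightarrow> vertex) \<Rightarrow> (nat \<Rightarrow> vertex) \<Rightarrow> vertex" where
  "tree_meet \<xi> \<zeta> = (ARG_MAX level x. x \<in> ray \<xi> \<inter> ray \<zeta>)"

definition rho :: "(nat \<Rightarrow> vertex) \<Rightarrow> (nat \<Rightarrow> vertex) \<Rightarrow> real" where
  "rho \<xi> \<zeta> = (if \<xi> = \<zeta> then 0 else (1/2) ^ level (tree_meet \<xi> \<zeta>))"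

definition boundary_topology :: "(nat \<Rightarrow> vertex) topology" where
  "boundary_topology = Metric_space.mtopology tree_boundary rho"

text \<open>
  Potentials and energies are sums of nonnegative reals that may diverge, hence take values in
  \<^typ>\<open>ennreal\<close>. The sum is over a set of vertices, so that \<^term>\<open>potential \<phi> (ray \<zeta>)\<close> is
  $I\varphi(\zeta)$ for a boundary point and \<^term>\<open>potential \<phi> (geodesic x)\<close> is $I\varphi(x)$ for a vertex.
\<close>

definition potential :: "(vertex \<Rightarrow> real) \<Rightarrow> vertex set \<Rightarrow> ennreal" where
  "potential \<phi> A = (\<Sum>\<^sub>\<infinity>x\<in>A. ennreal (\<phi> x))"

definition energy :: "(vertex \<Rightarrow> real) \<Rightarrow> ennreal" where
  "energy \<phi> = (\<Sum>\<^sub>\<infinity>x\<in>UNIV. ennreal ((\<phi> x)\<^sup>2))"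

definition admissible_funs :: "(nat \<Rightarrow> vertex) set \<Rightarrow> (vertex \<Rightarrow> real) set" where
  "admissible_funs E = {\<phi>. (\<forall>x. 0 \<le> \<phi> x) \<and> (\<forall>\<zeta>\<in>E. 1 \<le> potential \<phi> (ray \<zeta>))}"

definition Cap :: "(nat \<Rightarrow> vertex) set \<Rightarrow> ennreal" where
  "Cap E = (INF \<phi>\<in>admissible_funs E. energy \<phi>)"

definition Cap_n :: "nat \<Rightarrow> (nat \<Rightarrow> vertex) set \<Rightarrow> ennreal" where
  "Cap_n n E =
     (if n = 0 then Cap E
      else (INF \<phi>\<in>{\<phi> \<in> admissible_funs E. \<forall>x. level x = n - 1 \<longrightarrow> potential \<phi> (geodesic x) = 0}. energy \<phi>))"

text \<open>
  \<^const>\<open>Metric_space.mtopology\<close> is only meaningful for an actual metric, so we check that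
  \<^const>\<open>rho\<close> is one.
\<close>

lemma length_boundary:
  assumes "\<xi> \<in> tree_boundary"
  shows "length (\<xi> k) = k"
proof (induction k)
  case 0
  then show ?case using assms by (simp add: tree_boundary_def)
next
  case (Suc k)
  obtain b where "\<xi> (Suc k) = \<xi> k @ [b]"
    using assms by (auto simp: tree_boundary_def)
  then show ?case using Suc by simp
qed

lemma take_boundary:
  assumes "\<xi> \<in> tree_boundary" "k \<le> j"
  shows "take k (\<xi> j) = \<xi> k"
  using assms(2)
proof (induction rule: dec_induct)
  case base
  then show ?case using length_boundary[OF assms(1), of k] by simp
next
  case (step j)
  obtain b where "\<xi> (Suc j) = \<xi> j @ [b]"
    using assms(1) by (auto simp: tree_boundary_def)
  then show ?case using step length_boundary[OF assms(1), of j] by simp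
qed

lemma in_both_rays_iff:
  assumes "\<xi> \<in> tree_boundary" "\<zeta> \<in> tree_boundary"
  shows "x \<in> ray \<xi> \<inter> ray \<zeta> \<longleftrightarrow> \<xi> (length x) = x \<and> \<zeta> (length x) = x"
  unfolding ray_def using length_boundary assms by (smt (verit) IntE IntI imageE rangeI)

lemma agree_iff_le_level_meet:
  assumes \<xi>: "\<xi> \<in> tree_boundary" and \<zeta>: "\<zeta> \<in> tree_boundary" and ne: "\<xi> \<noteq> \<zeta>"
  shows "\<xi> k = \<zeta> k \<longleftrightarrow> k \<le> length (tree_meet \<xi> \<zeta>)"
proof -
  have down: "\<xi> i = \<zeta> i" if "\<xi> j = \<zeta> j" "i \<le> j" for i j
    using take_boundary[OF \<xi> that(2)] take_boundary[OF \<zeta> that(2)] that(1) by simp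
  have common: "\<xi> i \<in> ray \<xi> \<inter> ray \<zeta>" if "\<xi> i = \<zeta> i" for i
    unfolding in_both_rays_iff[OF \<xi> \<zeta>] using that length_boundary[OF \<xi>, of i] by simp
  obtain K where K: "\<xi> K \<noteq> \<zeta> K" using ne by auto
  have bound: "\<forall>x. x \<in> ray \<xi> \<inter> ray \<zeta> \<longrightarrow> length x < K"
  proof (intro allI impI)
    fix x assume "x \<in> ray \<xi> \<inter> ray \<zeta>"
    then have "\<xi> (length x) = \<zeta> (length x)"
      unfolding in_both_rays_iff[OF \<xi> \<zeta>] by simp
    then show "length x < K" using down K by (meson not_le)
  qed
  have "\<xi> 0 = \<zeta> 0"
    using \<xi> \<zeta> by (simp add: tree_boundary_def)
  then have "\<xi> 0 \<in> ray \<xi> \<inter> ray \<zeta>" by (rule common)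
  note max = arg_max_nat_lemma[where P = "\<lambda>x. x \<in> ray \<xi> \<inter> ray \<zeta>", OF this bound,
      folded tree_meet_def]
  have "\<xi> (length (tree_meet \<xi> \<zeta>)) = \<zeta> (length (tree_meet \<xi> \<zeta>))"
    using max unfolding in_both_rays_iff[OF \<xi> \<zeta>] by simp
  moreover have "k \<le> length (tree_meet \<xi> \<zeta>)" if "\<xi> k = \<zeta> k"
    using max common[OF that] length_boundary[OF \<xi>, of k] by metis
  ultimately show ?thesis using down by blast
qed

lemma Metric_space_tree_boundary: "Metric_space tree_boundary rho"
proof
  fix \<xi> \<zeta>
  show "0 \<le> rho \<xi> \<zeta>" by (simp add: rho_def)
  show "rho \<xi> \<zeta> = rho \<zeta> \<xi>" by (simp add: rho_def tree_meet_def Int_commute)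
  show "rho \<xi> \<zeta> = 0 \<longleftrightarrow> \<xi> = \<zeta>" by (simp add: rho_def)
next
  fix \<xi> \<eta> \<zeta>
  assume b: "\<xi> \<in> tree_boundary" "\<eta> \<in> tree_boundary" "\<zeta> \<in> tree_boundary"
  show "rho \<xi> \<zeta> \<le> rho \<xi> \<eta> + rho \<eta> \<zeta>"
  proof (cases "\<xi> = \<zeta> \<or> \<xi> = \<eta> \<or> \<eta> = \<zeta>")
    case True
    then show ?thesis by (auto simp: rho_def)
  next
    case False
    define m where "m = min (length (tree_meet \<xi> \<eta>)) (length (tree_meet \<eta> \<zeta>))"
    have "\<xi> m = \<eta> m" "\<eta> m = \<zeta> m"
      using False b by (simp_all add: agree_iff_le_level_meet m_def)
    then have "m \<le> length (tree_meet \<xi> \<zeta>)"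
      using agree_iff_le_level_meet[of \<xi> \<zeta> m] False b by simp
    then have "(1/2::real) ^ length (tree_meet \<xi> \<zeta>) \<le> (1/2) ^ m"
      by (intro power_decreasing) auto
    also have "\<dots> \<le> (1/2) ^ length (tree_meet \<xi> \<eta>) + (1/2) ^ length (tree_meet \<eta> \<zeta>)"
      by (auto simp: m_def min_def)
    finally show ?thesis using False by (simp add: rho_def)
  qed
qed

end

theory Submission imports Defs begin

text \<open>
  Let $E$ be the set of rays that turn freely $n$ times, follow the child
  \<^term>\<open>False\<close> for $m$ levels, and turn freely again afterwards. Its capacity is
  $1 / (2 + m / 2^n)$, while \<^term>\<open>Cap_n n E\<close> is at most $2^n / (m + 2)$. With
  $\delta = 1 / \epsilon - 2$ and $m = \lfloor 2^n \delta \rfloor$ these are at least $\epsilon$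
  and at most $1 / \delta$.

  The lower bound on the capacity is obtained by a greedy descent: at each vertex the ray moves to
  the permitted child whose subtree carries the least energy, and by Cauchy--Schwarz the potential
  accumulated along this ray is controlled by the square root of the total energy.
\<close>

section \<open>Closed sets of rays with turns prescribed level by level\<close>

text \<open>The permitted turns depend on the level only, not on the vertex. This homogeneity turns
  both capacity bounds into one-dimensional recursions in the level.\<close>

definition turn_boundary :: "(nat \<Rightarrow> bool set) \<Rightarrow> (nat \<Rightarrow> vertex) set" where
  "turn_boundary B = {\<zeta> \<in> tree_boundary. \<forall>k. \<exists>b\<in>B k. \<zeta> (Suc k) = \<zeta> k @ [b]}"

definition turn_vertices :: "(nat \<Rightarrow> bool set) \<Rightarrow> vertex set" where
  "turn_vertices B = {x. \<forall>k<length x. x ! k \<in> B k}"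

lemma turn_boundary_vertex:
  assumes "\<zeta> \<in> turn_boundary B"
  shows "\<zeta> k \<in> turn_vertices B"
proof (induction k)
  case 0
  then show ?case using assms by (simp add: turn_boundary_def tree_boundary_def turn_vertices_def)
next
  case (Suc k)
  obtain b where "b \<in> B k" "\<zeta> (Suc k) = \<zeta> k @ [b]"
    using assms by (auto simp: turn_boundary_def)
  moreover have "length (\<zeta> k) = k"
    using assms by (simp add: turn_boundary_def length_boundary)
  ultimately show ?case using Suc by (auto simp: turn_vertices_def nth_append less_Suc_eq)
qed

text \<open>A ray outside the set makes a forbidden turn at some level \<open>k\<close>. Every ray
  at distance less than \<open>(1/2) ^ k\<close> separates from it only below level
  \<open>k\<close>, hence makes the same turn.\<close>

lemma closedin_turn_boundary: "closedin boundary_topology (turn_boundary B)"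
proof -
  interpret Metric_space tree_boundary rho by (rule Metric_space_tree_boundary)
  show ?thesis
    unfolding boundary_topology_def closedin_metric
  proof (intro conjI allI impI)
    show "turn_boundary B \<subseteq> tree_boundary" by (auto simp: turn_boundary_def)
    fix \<zeta> assume "\<zeta> \<in> tree_boundary - turn_boundary B"
    then obtain k where \<zeta>: "\<zeta> \<in> tree_boundary" and k: "\<And>b. b \<in> B k \<Longrightarrow> \<zeta> (Suc k) \<noteq> \<zeta> k @ [b]"
      by (auto simp: turn_boundary_def)
    have "\<xi> \<notin> mball \<zeta> ((1/2) ^ k)" if \<xi>: "\<xi> \<in> turn_boundary B" for \<xi>
    proof
      assume "\<xi> \<in> mball \<zeta> ((1/2) ^ k)"
      then have \<xi>': "\<xi> \<in> tree_boundary" and r: "rho \<zeta> \<xi> < (1/2) ^ k" by auto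
      obtain b where b: "b \<in> B k" "\<xi> (Suc k) = \<xi> k @ [b]"
        using \<xi> by (auto simp: turn_boundary_def)
      then have ne: "\<zeta> \<noteq> \<xi>" using k by auto
      then have "k < length (tree_meet \<zeta> \<xi>)"
        using r by (simp add: rho_def power_strict_decreasing_iff)
      then have "\<zeta> k = \<xi> k" "\<zeta> (Suc k) = \<xi> (Suc k)"
        using agree_iff_le_level_meet[OF \<zeta> \<xi>' ne] by auto
      with b k show False by metis
    qed
    then have "disjnt (turn_boundary B) (mball \<zeta> ((1/2) ^ k))"
      unfolding disjnt_iff by blast
    moreover have "0 < (1/2::real) ^ k" by simp
    ultimately show "\<exists>r>0. disjnt (turn_boundary B) (mball \<zeta> r)" by blast
  qed
qed

section \<open>Lower bound for the capacity\<close>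

lemma infsum_subtree:
  fixes f :: "vertex \<Rightarrow> real"
  assumes "f summable_on UNIV"
  shows "infsum f {y. prefix x y} =
    f x + infsum f {y. prefix (x @ [True]) y} + infsum f {y. prefix (x @ [False]) y}"
proof -
  have s: "f summable_on A" for A
    using assms by (rule summable_on_subset_banach) simp
  have split: "{y. prefix x y} = ({x} \<union> {y. prefix (x @ [True]) y}) \<union> {y. prefix (x @ [False]) y}"
  proof (intro set_eqI iffI)
    fix y assume "y \<in> {y. prefix x y}"
    then obtain zs where y: "y = x @ zs" by (auto simp: prefix_def)
    show "y \<in> ({x} \<union> {y. prefix (x @ [True]) y}) \<union> {y. prefix (x @ [False]) y}"
    proof (cases zs)
      case (Cons b bs)
      then show ?thesis by (cases b) (auto simp: y)
    qed (simp add: y)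
  qed (auto simp: prefix_def)
  have disj: "({x} \<union> {y. prefix (x @ [True]) y}) \<inter> {y. prefix (x @ [False]) y} = {}"
    "{x} \<inter> {y. prefix (x @ [True]) y} = {}"
    by (auto simp: prefix_def)
  show ?thesis
    unfolding split infsum_Un_disjoint[OF s s disj(1)] infsum_Un_disjoint[OF s s disj(2)] by simp
qed

text \<open>One step of the descent: \<open>a\<close> is the value at the current vertex,
  \<open>W\<close> the energy of its subtree, \<open>b\<close> the number of permitted children and
  \<open>V\<close> the energy of the cheapest permitted subtree. The cross term of the square is
  absorbed by \<open>2 * a * s \<le> (c' / b) * a\<^sup>2 + b * V\<close>.\<close>

lemma greedy_step:
  fixes a b c c' V W :: real
  assumes "0 < b" "0 \<le> c'" "1 + c' / b \<le> c" "0 \<le> V" "a\<^sup>2 + b * V \<le> W"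
  shows "a + sqrt (c' * V) \<le> sqrt (c * W)"
proof (rule real_le_rsqrt)
  define s where "s = sqrt (c' * V)"
  have s2: "s\<^sup>2 = c' * V" using assms by (simp add: s_def)
  have r: "(sqrt (c' / b))\<^sup>2 = c' / b" "(sqrt (b * V))\<^sup>2 = b * V"
    using assms by auto
  have "s = sqrt (c' / b) * sqrt (b * V)"
    using assms by (simp add: s_def flip: real_sqrt_mult)
  then have "2 * a * s \<le> (c' / b) * a\<^sup>2 + b * V"
    using sum_squares_bound[of "sqrt (c' / b) * a" "sqrt (b * V)"] r
    by (simp add: power_mult_distrib algebra_simps)
  then have "(a + s)\<^sup>2 \<le> (1 + c' / b) * (a\<^sup>2 + b * V)"
    using s2 assms by (simp add: power2_sum algebra_simps)
  also have "\<dots> \<le> c * W"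
    using assms by (intro mult_mono) (auto intro: order_trans[of _ "1 + c' / b"])
  finally show "(a + sqrt (c' * V))\<^sup>2 \<le> c * W" by (simp add: s_def)
qed

text \<open>\<open>c k\<close> bounds from above the resistance (inverse capacity) of the permitted
  subtree at a vertex of level \<open>k\<close>: one unit for the vertex itself, in series with
  \<open>card (B k)\<close> parallel branches of resistance at most
  \<open>c (Suc k)\<close>.\<close>

lemma inverse_le_Cap_turn_boundary:
  fixes c :: "nat \<Rightarrow> real"
  assumes B: "\<And>k. B k \<noteq> {}" and c0: "\<And>k. 0 \<le> c k"
    and c: "\<And>k. 1 + c (Suc k) / card (B k) \<le> c k"
  shows "ennreal (1 / c 0) \<le> Cap (turn_boundary B)"
  unfolding Cap_def
proof (rule INF_greatest)
  fix \<phi> assume "\<phi> \<in> admissible_funs (turn_boundary B)"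
  then have \<phi>0: "\<And>x. 0 \<le> \<phi> x" and adm: "\<And>\<zeta>. \<zeta> \<in> turn_boundary B \<Longrightarrow> 1 \<le> potential \<phi> (ray \<zeta>)"
    by (auto simp: admissible_funs_def)
  define f where "f x = (\<phi> x)\<^sup>2" for x
  define W where "W x = infsum f {y. prefix x y}" for x
  show "ennreal (1 / c 0) \<le> energy \<phi>"
  proof (cases "energy \<phi> = top")
    case False
    then obtain e where e: "energy \<phi> = ennreal e" "0 \<le> e"
      by (cases "energy \<phi>") auto
    have fin: "sum f F \<le> e" if "finite F" for F
    proof -
      have "ennreal (sum f F) = (\<Sum>x\<in>F. ennreal (f x))"
        by (simp add: f_def)
      also have "\<dots> \<le> energy \<phi>"
        unfolding energy_def f_def using that by (subst nonneg_infsum_complete) (auto intro: SUP_upper)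
      finally show ?thesis using e by simp
    qed
    have sum: "f summable_on UNIV"
      using fin by (intro nonneg_bdd_above_summable_on bdd_aboveI[of _ e]) (auto simp: f_def)
    have W0: "0 \<le> W x" for x unfolding W_def by (intro infsum_nonneg) (simp add: f_def)
    have We: "W [] \<le> e"
      unfolding W_def using fin by (intro infsum_le_finite_sums summable_on_subset_banach[OF sum]) auto
    have W: "(\<phi> x)\<^sup>2 + (\<Sum>b\<in>B k. W (x @ [b])) \<le> W x" for x k
    proof -
      have "(\<Sum>b\<in>B k. W (x @ [b])) \<le> (\<Sum>b\<in>UNIV. W (x @ [b]))"
        by (intro sum_mono2) (auto simp: W0)
      also have "(\<phi> x)\<^sup>2 + \<dots> = W x"
        using infsum_subtree[OF sum, of x] by (simp add: W_def UNIV_bool f_def)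
      finally show ?thesis by simp
    qed
    \<comment> \<open>The minimum over the permitted children is at most their average.\<close>
    have "\<exists>b\<in>B k. card (B k) * W (x @ [b]) \<le> (\<Sum>b\<in>B k. W (x @ [b]))" for x k
    proof -
      obtain b where "b \<in> B k" "W (x @ [b]) = Min ((\<lambda>b. W (x @ [b])) ` B k)"
        using Min_in[of "(\<lambda>b. W (x @ [b])) ` B k"] B by fastforce
      then show ?thesis
        by (intro bexI[of _ b] sum_bounded_below) auto
    qed
    then obtain t where t: "\<And>k x. t k x \<in> B k"
      "\<And>k x. card (B k) * W (x @ [t k x]) \<le> (\<Sum>b\<in>B k. W (x @ [b]))"
      by metis
    define g where "g = rec_nat [] (\<lambda>k x. x @ [t k x])"
    have g: "g 0 = []" "g (Suc k) = g k @ [t k (g k)]" for k by (simp_all add: g_def)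
    have gE: "g \<in> turn_boundary B" using t by (auto simp: turn_boundary_def tree_boundary_def g)
    then have len: "length (g k) = k" for k by (simp add: turn_boundary_def length_boundary)
    have inj: "inj g" by (metis injI len)
    have step: "\<phi> (g k) + sqrt (c (Suc k) * W (g (Suc k))) \<le> sqrt (c k * W (g k))" for k
    proof (rule greedy_step)
      show "0 < real (card (B k))" using B by (simp add: card_gt_0_iff)
      show "(\<phi> (g k))\<^sup>2 + real (card (B k)) * W (g (Suc k)) \<le> W (g k)"
        using t(2)[of k "g k"] W[of "g k" k] by (simp add: g)
    qed (use c c0 W0 in auto)
    \<comment> \<open>The square root bounds what the ray can still collect below level
      \<open>N\<close>, so the steps telescope.\<close>
    have greedy: "(\<Sum>k<N. \<phi> (g k)) + sqrt (c N * W (g N)) \<le> sqrt (c 0 * W [])" for N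
    proof (induction N)
      case (Suc N)
      then show ?case using step[of N] by simp
    qed (simp add: g)
    have "1 \<le> potential \<phi> (ray g)" using adm gE by simp
    also have "\<dots> = infsum (\<lambda>k. ennreal (\<phi> (g k))) UNIV"
      unfolding potential_def ray_def using infsum_reindex[OF inj] by (simp add: o_def)
    also have "\<dots> \<le> ennreal (sqrt (c 0 * W []))"
    proof (rule infsum_le_finite_sums)
      fix F :: "nat set" assume "finite F"
      then obtain N where "F \<subseteq> {..<N}" using finite_nat_iff_bounded by blast
      then have "(\<Sum>k\<in>F. \<phi> (g k)) \<le> (\<Sum>k<N. \<phi> (g k))"
        by (intro sum_mono2) (auto simp: \<phi>0)
      also have "\<dots> \<le> sqrt (c 0 * W [])"
        using greedy[of N] c0 W0 by (smt (verit) mult_nonneg_nonneg real_sqrt_ge_zero)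
      finally show "(\<Sum>k\<in>F. ennreal (\<phi> (g k))) \<le> ennreal (sqrt (c 0 * W []))"
        by (simp add: \<phi>0 ennreal_leI)
    qed (simp add: nonneg_summable_on_complete)
    finally have "1 \<le> c 0 * W []" by simp
    also have "\<dots> \<le> c 0 * e" using We c0 by (intro mult_left_mono)
    finally have "1 / c 0 \<le> e"
      using c0[of 0] by (cases "c 0 = 0") (auto simp: field_simps)
    then show ?thesis by (simp add: e ennreal_leI)
  qed simp
qed

section \<open>Functions depending only on the level\<close>

lemma potential_level_fun:
  assumes \<zeta>: "\<zeta> \<in> turn_boundary B" and w0: "\<And>k. 0 \<le> w k" and w: "w sums s"
  shows "potential (\<lambda>x. if x \<in> turn_vertices B then w (level x) else 0) (ray \<zeta>) = ennreal s"
proof -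
  have len: "length (\<zeta> k) = k" for k using \<zeta> by (simp add: turn_boundary_def length_boundary)
  have inj: "inj \<zeta>" by (metis injI len)
  have hs: "(w has_sum s) UNIV" by (rule sums_nonneg_imp_has_sum[OF w w0])
  have "potential (\<lambda>x. if x \<in> turn_vertices B then w (level x) else 0) (ray \<zeta>)
      = infsum (ennreal \<circ> w) UNIV"
    unfolding potential_def ray_def infsum_reindex[OF inj]
    by (simp add: o_def len turn_boundary_vertex[OF \<zeta>])
  also have "\<dots> = ennreal (infsum w UNIV)"
    using hs w0 by (intro infsum_comm_additive_general)
      (auto simp: summable_on_def)
  finally show ?thesis using hs infsumI by blast
qed

text \<open>\<open>H k\<close> dominates the energy in the subtree of a permitted vertex of level
  \<open>k\<close>. Weighting its recursion by the number of permitted vertices of each level makes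
  it telescope; the nonnegative remainder is dropped, so \<open>H\<close> need not be shown to
  decay.\<close>

lemma energy_level_fun_le:
  fixes w H :: "nat \<Rightarrow> real"
  assumes H0: "\<And>k. 0 \<le> H k" and H: "\<And>k. (w k)\<^sup>2 + card (B k) * H (Suc k) \<le> H k"
  shows "energy (\<lambda>x. if x \<in> turn_vertices B then w (level x) else 0) \<le> ennreal (H 0)"
proof -
  define L where "L N = {x \<in> turn_vertices B. length x = N}" for N
  have L_Suc: "L (Suc N) = (\<lambda>(x, b). x @ [b]) ` (L N \<times> B N)" for N
  proof (intro set_eqI iffI)
    fix y assume y: "y \<in> L (Suc N)"
    then obtain x b where xb: "y = x @ [b]" "length x = N"
      by (auto simp: L_def length_Suc_conv_rev)
    have yB: "y ! k \<in> B k" if "k < Suc N" for k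
      using y that by (auto simp: L_def turn_vertices_def)
    have "x ! k \<in> B k" if "k < N" for k
      using yB[of k] that by (simp add: xb nth_append)
    then have "x \<in> L N" "b \<in> B N"
      using xb yB[of N] by (auto simp: L_def turn_vertices_def)
    then show "y \<in> (\<lambda>(x, b). x @ [b]) ` (L N \<times> B N)" using xb by auto
  qed (auto simp: L_def turn_vertices_def nth_append less_Suc_eq)
  have card_L: "card (L (Suc N)) = card (L N) * card (B N)" for N
    unfolding L_Suc by (subst card_image) (auto simp: inj_on_def card_cartesian_product)
  have fin_L: "finite (L N)" for N
    by (rule finite_subset[OF _ finite_lists_length_eq[of UNIV N]]) (auto simp: L_def)
  have L0: "L 0 = {[]}" by (auto simp: L_def turn_vertices_def)
  have telescope: "(\<Sum>k<N. card (L k) * (w k)\<^sup>2) + card (L N) * H N \<le> H 0" for N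
  proof (induction N)
    case (Suc N)
    have "card (L N) * (w N)\<^sup>2 + card (L (Suc N)) * H (Suc N) \<le> card (L N) * H N"
      using mult_left_mono[OF H[of N], of "card (L N)"] by (simp add: card_L algebra_simps)
    with Suc show ?case by simp
  qed (simp add: L0)
  show ?thesis
    unfolding energy_def
  proof (rule infsum_le_finite_sums)
    fix F :: "vertex set" assume F: "finite F"
    \<comment> \<open>For empty \<open>F\<close> the value of \<open>Max\<close> is unspecified, but
      then any \<open>N\<close> will do.\<close>
    define N where "N = Suc (Max (length ` F))"
    define v where "v x = (if x \<in> turn_vertices B then w (level x) else 0)\<^sup>2" for x
    have "length x < N" if "x \<in> F" for x
      using F that by (auto simp: N_def less_Suc_eq_le)
    then have sub: "F \<inter> turn_vertices B \<subseteq> (\<Union>k<N. L k)" by (auto simp: L_def)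
    have "sum v F = sum v (F \<inter> turn_vertices B)"
      using F by (intro sum.mono_neutral_right) (auto simp: v_def)
    also have "\<dots> \<le> sum v (\<Union>k<N. L k)"
      using sub fin_L by (intro sum_mono2) (auto simp: v_def)
    also have "\<dots> = (\<Sum>k<N. sum v (L k))"
      by (rule sum.UNION_disjoint) (use fin_L in blast, use fin_L in blast, auto simp: L_def)
    also have "\<dots> = (\<Sum>k<N. card (L k) * (w k)\<^sup>2)"
      by (intro sum.cong) (auto simp: L_def v_def)
    also have "\<dots> \<le> H 0" using telescope[of N] H0[of N]
      by (smt (verit) mult_nonneg_nonneg of_nat_0_le_iff)
    finally show "(\<Sum>x\<in>F. ennreal ((if x \<in> turn_vertices B then w (level x) else 0)\<^sup>2)) \<le> ennreal (H 0)"
      by (simp add: v_def ennreal_leI)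
  qed (simp add: nonneg_summable_on_complete)
qed

text \<open>Geodesics to level \<open>n - 1\<close> only meet levels below \<open>n\<close>. For
  \<open>n = 0\<close> the vanishing condition is vacuous, in accordance with \<open>Cap_n 0\<close>
  being \<open>Cap\<close>.\<close>

lemma Cap_n_le_energy:
  assumes "\<phi> \<in> admissible_funs E" and "\<And>x. level x < n \<Longrightarrow> \<phi> x = 0"
  shows "Cap_n n E \<le> energy \<phi>"
proof (cases "n = 0")
  case True
  then show ?thesis using assms by (auto simp: Cap_n_def Cap_def intro: INF_lower)
next
  case False
  have "potential \<phi> (geodesic x) = 0" if "level x = n - 1" for x
    unfolding potential_def
  proof (rule infsum_0)
    fix y assume "y \<in> geodesic x"
    then have "length y < n" using that False prefix_length_le[of y x] by (auto simp: geodesic_def)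
    then show "ennreal (\<phi> y) = 0" using assms by simp
  qed
  then show ?thesis using False assms by (auto simp: Cap_n_def intro: INF_lower)
qed

section \<open>Rays with a long forced stretch\<close>

definition stretch_turns :: "nat \<Rightarrow> nat \<Rightarrow> nat \<Rightarrow> bool set" where
  "stretch_turns n m k = (if n \<le> k \<and> k < n + m then {False} else UNIV)"

lemma Cap_stretch_ge:
  "ennreal (1 / (2 + m / 2 ^ n)) \<le> Cap (turn_boundary (stretch_turns n m))"
proof -
  \<comment> \<open>The free dyadic tree has resistance 2, the fixed point of
    \<open>c = 1 + c / 2\<close>. Each forced turn adds 1, giving \<open>2 + m\<close> at level
    \<open>n\<close>; each free level above keeps the 2 and halves the excess. Truncated subtraction
    merges the three regimes.\<close>
  define c where "c k = 2 + real (m - (k - n)) / 2 ^ (n - k)" for k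
  have "ennreal (1 / c 0) \<le> Cap (turn_boundary (stretch_turns n m))"
  proof (rule inverse_le_Cap_turn_boundary)
    fix k
    consider "k < n" | "n \<le> k" "k < n + m" | "n + m \<le> k" by linarith
    then show "1 + c (Suc k) / card (stretch_turns n m k) \<le> c k"
    proof cases
      case 1
      then have "n - k = Suc (n - Suc k)" by simp
      with 1 show ?thesis by (simp add: c_def stretch_turns_def add_divide_distrib)
    qed (auto simp: c_def stretch_turns_def of_nat_diff)
  qed (auto simp: stretch_turns_def c_def)
  then show ?thesis by (simp add: c_def)
qed

lemma Cap_n_stretch_le:
  "Cap_n n (turn_boundary (stretch_turns n m)) \<le> ennreal (2 ^ n / (real m + 2))"
proof -
  \<comment> \<open>The optimal profile of a subtree rooted at level \<open>n\<close>: constant on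
    levels \<open>n\<close> to \<open>n + m\<close> (the truncated exponent is 0 there), then halved
    at each free level. The factor \<open>1 / (m + 2)\<close> normalizes the total along a ray to
    1.\<close>
  define w where "w k = (if n \<le> k then (1/2) ^ (k - (n + m)) / real (m + 2) else 0)" for k
  \<comment> \<open>The exact energy below a permitted vertex: a free subtree whose root has value
    \<open>a\<close> carries \<open>2 * a\<^sup>2\<close>, each forced vertex adds one equal square,
    and above level \<open>n\<close> there are \<open>2 ^ (n - k)\<close> identical copies.\<close>
  define H where "H k = 2 ^ (n - k) * (real (m - (k - n)) + 2) / 4 ^ (k - (n + m)) / (real (m + 2))\<^sup>2" for k
  define \<phi> where "\<phi> x = (if x \<in> turn_vertices (stretch_turns n m) then w (level x) else 0)" for x
  have w0: "0 \<le> w k" for k by (simp add: w_def)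
  \<comment> \<open>The geometric tail includes level \<open>n + m\<close>; the forced levels before
    it contribute \<open>m / (m + 2)\<close>.\<close>
  have "(\<lambda>i. w (i + (n + m))) sums (2 / real (m + 2))"
    using sums_divide[OF geometric_sums[of "1/2::real"], of "real (m + 2)"] by (simp add: w_def)
  then have "w sums (2 / real (m + 2) + (\<Sum>i<n + m. w i))"
    by (simp add: sums_iff_shift)
  moreover have "(\<Sum>i<n + m. w i) = (\<Sum>i\<in>{n..<n + m}. 1 / real (m + 2))"
    by (rule sum.mono_neutral_cong_right) (auto simp: w_def)
  ultimately have "w sums 1"
    by (simp add: add_divide_distrib[symmetric])
  then have "\<phi> \<in> admissible_funs (turn_boundary (stretch_turns n m))"
    unfolding admissible_funs_def \<phi>_def by (auto simp: potential_level_fun w0)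
  then have "Cap_n n (turn_boundary (stretch_turns n m)) \<le> energy \<phi>"
    by (rule Cap_n_le_energy) (simp add: \<phi>_def w_def)
  also have "\<dots> \<le> ennreal (H 0)"
    unfolding \<phi>_def
  proof (rule energy_level_fun_le)
    fix k
    show "0 \<le> H k" by (simp add: H_def)
    consider "k < n" | "n \<le> k" "k < n + m" | "n + m \<le> k" by linarith
    then show "(w k)\<^sup>2 + card (stretch_turns n m k) * H (Suc k) \<le> H k"
    proof cases
      case 1
      then have "n - k = Suc (n - Suc k)" by simp
      with 1 show ?thesis by (simp add: w_def H_def stretch_turns_def)
    next
      case 2
      then show ?thesis
        by (simp add: w_def H_def stretch_turns_def of_nat_diff power_divide algebra_simps
            flip: add_divide_distrib)
    next
      case 3
      then have "(w k)\<^sup>2 = 1 / 4 ^ (k - (n + m)) / (real (m + 2))\<^sup>2"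
        by (simp add: w_def power_divide power2_eq_square flip: power_mult_distrib)
      with 3 show ?thesis
        by (simp add: H_def stretch_turns_def Suc_diff_le field_simps)
    qed
  qed
  also have "H 0 = 2 ^ n / (real m + 2)" by (simp add: H_def power2_eq_square add.commute)
  finally show ?thesis .
qed

theorem theorem4:
  fixes \<epsilon> :: real
  assumes "0 < \<epsilon>" and "\<epsilon> < 1 / 2"
  shows "\<exists>R::real. 0 < R \<and>
    (\<forall>n::nat. \<exists>E. closedin boundary_topology E \<and>
      ennreal \<epsilon> \<le> Cap E \<and> Cap_n n E \<le> ennreal R)"
proof -
  \<comment> \<open>The hypothesis \<epsilon> < 1/2 enters as positivity of \<delta>; 1/2 is the
    capacity of the whole boundary.\<close>
  define \<delta> where "\<delta> = 1 / \<epsilon> - 2"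
  have \<delta>: "0 < \<delta>" using assms by (simp add: \<delta>_def field_simps)
  have "\<exists>E. closedin boundary_topology E \<and> ennreal \<epsilon> \<le> Cap E \<and> Cap_n n E \<le> ennreal (1 / \<delta>)" for n
  proof (intro exI conjI)
    \<comment> \<open>The largest \<open>m\<close> for which the resistance
      \<open>2 + m / 2 ^ n\<close> stays within \<open>1 / \<epsilon>\<close>. Its maximality forces
      \<open>m + 1\<close> above \<open>2 ^ n * \<delta>\<close>, which cancels the factor
      \<open>2 ^ n\<close> in the bound for \<open>Cap_n\<close>.\<close>
    define m where "m = nat \<lfloor>2 ^ n * \<delta>\<rfloor>"
    have "0 \<le> 2 ^ n * \<delta>" using \<delta> by simp
    then have m: "real m \<le> 2 ^ n * \<delta>" "2 ^ n * \<delta> < m + 1"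
      unfolding m_def by linarith+
    show "closedin boundary_topology (turn_boundary (stretch_turns n m))"
      by (rule closedin_turn_boundary)
    have "2 + m / 2 ^ n \<le> 1 / \<epsilon>" using m by (simp add: \<delta>_def field_simps)
    then have "\<epsilon> \<le> 1 / (2 + m / 2 ^ n)"
      using assms le_imp_inverse_le[of "2 + m / 2 ^ n" "1 / \<epsilon>"]
      by (simp add: inverse_eq_divide add_pos_nonneg)
    then show "ennreal \<epsilon> \<le> Cap (turn_boundary (stretch_turns n m))"
      by (intro order_trans[OF ennreal_leI Cap_stretch_ge])
    have "2 ^ n / (real m + 2) \<le> 1 / \<delta>" using m \<delta> by (simp add: field_simps)
    then show "Cap_n n (turn_boundary (stretch_turns n m)) \<le> ennreal (1 / \<delta>)"
      by (intro order_trans[OF Cap_n_stretch_le ennreal_leI])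
  qed
  then show ?thesis using \<delta> by (intro exI[of _ "1 / \<delta>"]) auto
qed

end
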